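(* Let $\mathbb{T}\colon\mathbb{R}^n\to\mathbb{R}^n$ be $\gamma^{-1}$-contractive with $\gamma\ge 1$. Assume $\mathbb{T}$ has a fixed point and let $y_\star\in\mathrm{Fix}\,\mathbb{T}$. Let $\varphi_k=\sum_{i=0}^k\gamma^{2i}$, let $y_0\in\mathbb{R}^n$ be a starting point, and let (OC-Halpern) be the iteration \[ y_k=\left(1-\frac{1}{\varphi_k}\right)\mathbb{T}y_{k-1}+\frac{1}{\varphi_k}y_0,\qquad k=1,2,\dots. \] Then for every $N=0,1,\dots$, \[ \|y_N-\mathbb{T}y_N\|^2\le\left(1+\frac1\gamma\right)^2\left(\frac{1}{\sum_{k=0}^{N}\gamma^k}\right)^2\|y_0-y_\star\|^2. \]
   Context: $\mathbb{R}^n$ carries the standard inner product and norm. "$\gamma^{-1}$-contractive" means $\|\mathbb{T}x-\mathbb{T}y\|\le\gamma^{-1}\|x-y\|$ for all $x,y\in\mathbb{R}^n$ (for $\gamma=1$ this is nonexpansiveness). $\mathrm{Fix}\,\mathbb{T}=\{y:\mathbb{T}y=y\}$. *)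

theory Defs
  imports "HOL-Analysis.Analysis"
begin

definition Fix :: "('a \<Rightarrow> 'a) \<Rightarrow> 'a set" where
  "Fix T = {y. T y = y}"

definition phi :: "real \<Rightarrow> nat \<Rightarrow> real" where
  "phi \<gamma> k = (\<Sum>i=0..k. \<gamma> ^ (2 * i))"

primrec oc_halpern ::
  "real \<Rightarrow> ('a::real_vector \<Rightarrow> 'a) \<Rightarrow> 'a \<Rightarrow> nat \<Rightarrow> 'a" where
  "oc_halpern \<gamma> T y0 0 = y0"
| "oc_halpern \<gamma> T y0 (Suc k) =
     (1 - 1 / phi \<gamma> (Suc k)) *\<^sub>R T (oc_halpern \<gamma> T y0 k) + (1 / phi \<gamma> (Suc k)) *\<^sub>R y0"

end

theory Submission
  imports Defs
begin

text \<open>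
  Write \<open>d = y\<^sub>k - T y\<^sub>k\<close> and measure all points relative to \<open>y0\<close>. The contraction inequalities
  between consecutive iterates telescope, with weights \<open>\<gamma>\<^sup>-\<^sup>2\<^sup>k \<phi>\<^sub>k \<phi>\<^sub>k\<^sub>-\<^sub>1\<close>, into
  \<open>\<gamma>\<^sup>2 \<phi>\<^sub>k |d|\<^sup>2 \<le> \<gamma>\<^sup>2 |T y\<^sub>k|\<^sup>2 - |y\<^sub>k|\<^sup>2\<close>. With \<open>v = \<gamma>\<^sup>2 T y\<^sub>k - y\<^sub>k\<close> and \<open>\<gamma> > 1\<close>, completing squares
  turns this into \<open>|v| \<ge> \<gamma>\<^sup>k\<^sup>+\<^sup>2 |d|\<close>, and the contraction towards the fixed point \<open>w\<close> into
  \<open>|(\<gamma>\<^sup>2 - 1) w - v| \<le> \<gamma> |d|\<close>; the triangle inequality gives the rate.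
\<close>

lemma phi_0 [simp]: "phi \<gamma> 0 = 1"
  by (simp add: phi_def)

lemma phi_Suc: "phi \<gamma> (Suc k) = 1 + \<gamma>\<^sup>2 * phi \<gamma> k"
proof -
  have "phi \<gamma> (Suc k) = 1 + (\<Sum>i=0..k. \<gamma> ^ (2 * Suc i))"
    unfolding phi_def by (subst sum.atLeast0_atMost_Suc_shift) simp
  then show ?thesis
    by (simp add: phi_def sum_distrib_left power2_eq_square mult.assoc)
qed

lemma phi_pos: "phi \<gamma> k > 0"
  by (induction k) (simp_all add: phi_Suc add_pos_nonneg)

text \<open>The geometric sum with ratio \<open>\<gamma>\<^sup>2\<close>, kept multiplied out so
  that \<open>\<gamma> = 1\<close> is covered.\<close>

lemma phi_geometric: "(\<gamma>\<^sup>2 - 1) * phi \<gamma> k = (\<gamma> ^ Suc k)\<^sup>2 - 1"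
proof (induction k)
  case (Suc k)
  have "(\<gamma>\<^sup>2 - 1) * phi \<gamma> (Suc k) = (\<gamma>\<^sup>2 - 1) + \<gamma>\<^sup>2 * ((\<gamma>\<^sup>2 - 1) * phi \<gamma> k)"
    by (simp add: phi_Suc algebra_simps)
  then show ?case
    unfolding Suc by (simp add: power_mult_distrib algebra_simps)
qed simp

text \<open>Induction step for the residual estimate. Relative to \<open>y0\<close>,
  \<open>z\<close> and \<open>y\<close> are consecutive iterates, \<open>s\<close> and
  \<open>t\<close> their images under \<open>T\<close>; \<open>g\<close> is
  \<open>\<gamma>\<^sup>2\<close> and \<open>1 + a\<close> the new \<open>phi\<close>. The claim
  scaled by \<open>(1 + a) / a\<close> is \<open>1 + a\<close> times \<open>contr\<close> plus
  \<open>IH\<close>.\<close>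

lemma halpern_step:
  fixes s t y z :: "'a::real_inner" and g a :: real
  assumes a: "a > 0"
    and y: "y = (a / (1 + a)) *\<^sub>R s"
    and contr: "g * (norm (t - s))\<^sup>2 \<le> (norm (y - z))\<^sup>2"
    and IH: "a * (norm (z - s))\<^sup>2 \<le> g * (norm s)\<^sup>2 - (norm z)\<^sup>2"
  shows "g * (1 + a) * (norm (y - t))\<^sup>2 \<le> g * (norm t)\<^sup>2 - (norm y)\<^sup>2"
proof -
  define r where "r = (1 + a) / a"
  have r: "r > 0" and ar: "a * r = 1 + a"
    using a by (simp_all add: r_def)
  have s: "s = r *\<^sub>R y"
    using a y by (simp add: r_def)
  let ?G = "g * (1 + a) * (norm (y - t))\<^sup>2 - g * (norm t)\<^sup>2 + (norm y)\<^sup>2"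
  let ?H = "g * (norm (t - s))\<^sup>2 - (norm (y - z))\<^sup>2"
  let ?K = "a * (norm (z - s))\<^sup>2 - g * (norm s)\<^sup>2 + (norm z)\<^sup>2"
  \<comment> \<open>With \<open>r\<close> and \<open>a\<close> treated as independent, this is a
    polynomial identity free of division; the relation \<open>ar\<close> then makes the right-hand
    side vanish.\<close>
  have "r * ?G - ((1 + a) * ?H + ?K)
    = (a * r - (1 + a)) * (g * inner t t - (r * g + r + 1) * inner y y + 2 * inner y z)"
    unfolding s power2_norm_eq_inner inner_diff_left inner_diff_right
      inner_scaleR_left inner_scaleR_right inner_commute[of t y] inner_commute[of z y]
    by (simp add: algebra_simps)
  then have "r * ?G = (1 + a) * ?H + ?K"
    using ar by simp
  also have "\<dots> \<le> 0"
    using mult_nonneg_nonpos[of "1 + a" ?H] a contr IH by linarith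
  finally have "?G \<le> 0"
    using r by (simp only: mult_le_0_iff) linarith
  then show ?thesis
    by simp
qed

text \<open>By induction on \<open>k\<close>; the base case is an equality, since the first iterate
  is \<open>y0\<close> and \<open>phi \<gamma> 0 = 1\<close>.\<close>

lemma halpern_invariant:
  fixes T :: "'a::real_inner \<Rightarrow> 'a"
    and y0 :: 'a
  assumes "\<gamma> > 0"
    and lip: "\<And>x y. \<gamma>\<^sup>2 * (norm (T x - T y))\<^sup>2 \<le> (norm (x - y))\<^sup>2"
  defines "y \<equiv> oc_halpern \<gamma> T y0"
  shows "\<gamma>\<^sup>2 * phi \<gamma> k * (norm (y k - T (y k)))\<^sup>2
    \<le> \<gamma>\<^sup>2 * (norm (T (y k) - y0))\<^sup>2 - (norm (y k - y0))\<^sup>2"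
proof (induction k)
  case 0
  then show ?case
    by (simp add: y_def norm_minus_commute)
next
  case (Suc k)
  define a where "a = \<gamma>\<^sup>2 * phi \<gamma> k"
  have a: "a > 0"
    using \<open>\<gamma> > 0\<close> by (simp add: a_def phi_pos)
  have phi: "phi \<gamma> (Suc k) = 1 + a"
    by (simp add: phi_Suc a_def)
  \<comment> \<open>Relative to \<open>y0\<close> the anchor term drops out, so the update only
    scales \<open>T (y k) - y0\<close>, by \<open>1 - 1 / (1 + a)\<close>.\<close>
  have y: "y (Suc k) - y0 = (a / (1 + a)) *\<^sub>R (T (y k) - y0)"
  proof -
    have r: "1 / (1 + a) = 1 - a / (1 + a)"
      using a by (simp add: field_simps)
    show ?thesis
      unfolding y_def oc_halpern.simps phi r by (simp add: algebra_simps)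
  qed
  have "\<gamma>\<^sup>2 * (1 + a) * (norm ((y (Suc k) - y0) - (T (y (Suc k)) - y0)))\<^sup>2
    \<le> \<gamma>\<^sup>2 * (norm (T (y (Suc k)) - y0))\<^sup>2 - (norm (y (Suc k) - y0))\<^sup>2"
    by (rule halpern_step[OF a y, where z = "y k - y0"]) (use lip Suc in \<open>simp_all add: a_def\<close>)
  then show ?case
    by (simp add: phi)
qed

text \<open>Here \<open>y\<close>, \<open>t\<close> and \<open>w\<close> stand for an iterate, its
  image and the fixed point, each minus \<open>y0\<close>. For \<open>\<gamma> = 1\<close> the
  factor \<open>\<gamma>\<^sup>2 - 1\<close> degenerates, so that case adds \<open>inv\<close> and
  \<open>contr\<close> and applies Cauchy-Schwarz.\<close>

lemma residual_bound:
  fixes t y w :: "'a::real_inner"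
  assumes \<gamma>: "\<gamma> \<ge> 1"
    and inv: "\<gamma>\<^sup>2 * phi \<gamma> N * (norm (y - t))\<^sup>2 \<le> \<gamma>\<^sup>2 * (norm t)\<^sup>2 - (norm y)\<^sup>2"
    and contr: "\<gamma>\<^sup>2 * (norm (t - w))\<^sup>2 \<le> (norm (y - w))\<^sup>2"
  shows "\<gamma> * (\<Sum>k=0..N. \<gamma> ^ k) * norm (y - t) \<le> (\<gamma> + 1) * norm w"
proof (cases "\<gamma> = 1")
  case True
  have "phi \<gamma> N * (norm (y - t))\<^sup>2 \<le> 2 * inner w (t - y)"
    using inv contr unfolding True power2_norm_eq_inner
    by (simp add: inner_diff_left inner_diff_right inner_commute)
  also have "\<dots> \<le> 2 * (norm w * norm (y - t))"
    using norm_cauchy_schwarz[of w "t - y"] by (simp add: norm_minus_commute)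
  finally have "norm (y - t) * (phi \<gamma> N * norm (y - t)) \<le> norm (y - t) * (2 * norm w)"
    by (simp add: power2_eq_square algebra_simps)
  then have "phi \<gamma> N * norm (y - t) \<le> 2 * norm w"
    by (cases "y = t") simp_all
  then show ?thesis
    by (simp add: True phi_def)
next
  case False
  with \<gamma> have q: "\<gamma>\<^sup>2 - 1 > 0"
    by (simp add: power2_eq_square less_1_mult)
  define v where "v = \<gamma>\<^sup>2 *\<^sub>R t - y"
  define p where "p = \<gamma> ^ Suc N"
  have v_sq: "(norm v)\<^sup>2 = (\<gamma>\<^sup>2 - 1) * (\<gamma>\<^sup>2 * (norm t)\<^sup>2 - (norm y)\<^sup>2) + (\<gamma> * norm (y - t))\<^sup>2"
    unfolding v_def power_mult_distrib power2_norm_eq_inner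
    by (simp add: inner_diff_left inner_diff_right inner_commute[of y t] algebra_simps power2_eq_square)
  have "(\<gamma> * p * norm (y - t))\<^sup>2 \<le> (norm v)\<^sup>2"
  proof -
    have "(\<gamma> * p * norm (y - t))\<^sup>2
      = (1 + (\<gamma>\<^sup>2 - 1) * phi \<gamma> N) * (\<gamma> * norm (y - t))\<^sup>2"
      unfolding phi_geometric p_def by (simp add: power_mult_distrib)
    then show ?thesis
      using mult_left_mono[OF inv less_imp_le[OF q]] unfolding v_sq
      by (simp add: power_mult_distrib algebra_simps)
  qed
  then have lower: "\<gamma> * p * norm (y - t) \<le> norm v"
    by (rule power2_le_imp_le) simp
  \<comment> \<open>Apollonius: \<open>contr\<close> places \<open>w\<close> in the ball with centre
    \<open>v / (\<gamma>\<^sup>2 - 1)\<close> and radius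
    \<open>\<gamma> * norm (y - t) / (\<gamma>\<^sup>2 - 1)\<close>.\<close>
  have "(norm ((\<gamma>\<^sup>2 - 1) *\<^sub>R w - v))\<^sup>2 - (\<gamma> * norm (y - t))\<^sup>2
    = (\<gamma>\<^sup>2 - 1) * (\<gamma>\<^sup>2 * (norm (t - w))\<^sup>2 - (norm (y - w))\<^sup>2)"
    unfolding v_def power_mult_distrib power2_norm_eq_inner
    by (simp add: inner_diff_left inner_diff_right inner_commute[of y t] inner_commute[of w t] inner_commute[of w y]
        algebra_simps power2_eq_square)
  also have "\<dots> \<le> 0"
    using q contr by (simp add: mult_le_0_iff)
  finally have "(norm ((\<gamma>\<^sup>2 - 1) *\<^sub>R w - v))\<^sup>2 \<le> (\<gamma> * norm (y - t))\<^sup>2"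
    by simp
  then have "norm ((\<gamma>\<^sup>2 - 1) *\<^sub>R w - v) \<le> \<gamma> * norm (y - t)"
    by (rule power2_le_imp_le) (use \<gamma> in simp)
  then have "norm v \<le> (\<gamma>\<^sup>2 - 1) * norm w + \<gamma> * norm (y - t)"
    using norm_triangle_ineq4[of "(\<gamma>\<^sup>2 - 1) *\<^sub>R w" "(\<gamma>\<^sup>2 - 1) *\<^sub>R w - v"] q by simp
  with lower have "(p - 1) * (\<gamma> * norm (y - t)) \<le> (\<gamma>\<^sup>2 - 1) * norm w"
    by (simp add: algebra_simps)
  \<comment> \<open>Both \<open>p - 1\<close> and \<open>\<gamma>\<^sup>2 - 1\<close> contain the
    factor \<open>\<gamma> - 1\<close>; cancelling it leaves the sum and
    \<open>\<gamma> + 1\<close>.\<close>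
  moreover have "p - 1 = (\<gamma> - 1) * (\<Sum>k=0..N. \<gamma> ^ k)"
    unfolding p_def by (simp only: power_diff_1_eq lessThan_Suc_atMost atMost_atLeast0)
  ultimately have "(\<gamma> - 1) * (\<gamma> * (\<Sum>k=0..N. \<gamma> ^ k) * norm (y - t))
      \<le> (\<gamma> - 1) * ((\<gamma> + 1) * norm w)"
    by (simp add: power2_eq_square algebra_simps)
  then show ?thesis
    using \<gamma> False by (simp add: mult_le_cancel_left)
qed

theorem corollary3p3:
  fixes T :: "real ^ 'n \<Rightarrow> real ^ 'n"
    and \<gamma> :: real
    and y0 ystar :: "real ^ 'n"
    and N :: nat
  assumes "\<gamma> \<ge> 1"
    and "(inverse \<gamma>)-lipschitz_on UNIV T"
    and "ystar \<in> Fix T"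
  shows "(norm (oc_halpern \<gamma> T y0 N - T (oc_halpern \<gamma> T y0 N)))\<^sup>2
    \<le> (1 + 1 / \<gamma>)\<^sup>2 * (1 / (\<Sum>k=0..N. \<gamma> ^ k))\<^sup>2 * (norm (y0 - ystar))\<^sup>2"
proof -
  define y where "y = oc_halpern \<gamma> T y0 N"
  define S where "S = (\<Sum>k=0..N. \<gamma> ^ k)"
  have \<gamma>: "\<gamma> > 0"
    using assms(1) by simp
  have S: "S > 0"
    unfolding S_def using \<gamma> by (intro sum_pos) auto
  have lip: "\<gamma>\<^sup>2 * (norm (T a - T b))\<^sup>2 \<le> (norm (a - b))\<^sup>2" for a b
  proof -
    have "norm (T a - T b) \<le> inverse \<gamma> * norm (a - b)"
      using lipschitz_onD[OF assms(2), of a b] by (simp add: dist_norm)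
    then have "\<gamma> * norm (T a - T b) \<le> norm (a - b)"
      using \<gamma> by (simp add: field_simps)
    then show ?thesis
      unfolding power_mult_distrib[symmetric] using \<gamma> by (intro power_mono) auto
  qed
  have "T ystar = ystar"
    using assms(3) by (simp add: Fix_def)
  \<comment> \<open>\<open>residual_bound\<close> is used with \<open>w = ystar - y0\<close>; as
    \<open>ystar\<close> is fixed, \<open>lip\<close> at \<open>ystar\<close> is its contraction
    hypothesis.\<close>
  then have "\<gamma> * S * norm ((y - y0) - (T y - y0)) \<le> (\<gamma> + 1) * norm (ystar - y0)"
    unfolding S_def y_def
    using halpern_invariant[OF \<gamma> lip] lip[of _ ystar]
    by (intro residual_bound[OF assms(1)]) simp_all
  then have "norm (y - T y) \<le> (1 + 1 / \<gamma>) * (1 / S) * norm (y0 - ystar)"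
    using \<gamma> S by (simp add: norm_minus_commute field_simps)
  then show ?thesis
    unfolding power_mult_distrib[symmetric] y_def S_def by (intro power_mono) auto
qed

end
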